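(* Let $S$ be a finite set of $n>1$ configurations, equipped with a switching cost function $sc$. For every Moving Target Defense (MTD) defense strategy on $S$, there exists an adaptive adversary $(r_t)_{t\ge 1}$ such that the defender's policy regret with switching costs, compared to the best static configuration in hindsight, is $\Omega(T)$. That is, there exist a constant $c>0$ and $T_0\in\mathbb{N}$ such that for all $T\ge T_0$, $$\max_{b\in S}\ \sum_{t=1}^{T} r_t(\underbrace{b,b,\ldots,b}_{t})\;-\;\mathbb{E}\left[\sum_{t=1}^{T}\Big(r_t(\mathbf{A}_1,\ldots,\mathbf{A}_t)-sc(\mathbf{A}_{t-1},\mathbf{A}_t)\Big)\right]\;\ge\; c\,T,$$ where $\mathbf{A}_1,\mathbf{A}_2,\ldots$ is the (random) sequence of configurations chosen by the defense strategy when facing this adversary and $\mathbf{A}_0=s_0$ is the fixed initial configuration.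
   Context: Setting. A defender repeatedly chooses a configuration of a system from a finite set $S$ with $|S|=n$, starting from a fixed initial configuration $s_0\in S$ (so $\mathbf{A}_0=s_0$). At each timestep $t=1,2,\ldots$ the defender picks (possibly at random) the configuration $\mathbf{A}_t\in S$ to switch to (or stay in). Switching cost. A function $sc:S\times S\to[0,1]$ with $sc(s,s')=0$ if $s=s'$ and $sc(s,s')\in(0,1]$ if $s\ne s'$. Adaptive adversary. A sequence of reward functions $(r_t)_{t\ge1}$, $r_t:S^t\to[0,1]$, where $r_t(s_1,\ldots,s_t)$ is the defender's reward (before switching cost) at timestep $t$. It may depend on the whole history of configurations $s_1,\ldots,s_t$ deployed by the defender up to and including time $t$. The functions $r_t$ are not known in advance to the defender. MTD defense strategy. A (possibly randomized) online algorithm that, at each timestep $t$, selects $\mathbf{A}_t\in S$ according to a probability distribution depending only on the past configurations $\mathbf{A}_0,\ldots,\mathbf{A}_{t-1}$ and the feedback (rewards) observed at timesteps $1,\ldots,t-1$. In particular, the distribution of $\mathbf{A}_1$ does not depend on the adversary. Policy regret with switching costs, compared to the best static configuration. The competitor class consists of constant sequences $(b,b,\ldots,b)$, $b\in S$. The reward of a competitor is the reward $\sum_{t=1}^T r_t(b,\ldots,b)$ it would have received had the constant sequence been played from the start (so that the adversary reacts to the constant history), and constant competitors are charged no switching cost at all, including at $t=1$. The defender's total is $\sum_{t=1}^T \big(r_t(\mathbf{A}_1,\ldots,\mathbf{A}_t)-sc(\mathbf{A}_{t-1},\mathbf{A}_t)\big)$. Policy regret is the maximal competitor reward minus the expected total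 of the defender, the expectation being over the defender's randomness. The quantifier order is: the strategy is given first and the adversary may depend on it. The adversary does not depend on $T$. The constants $c$ and $T_0$ may depend on $n$ and on the strategy. *)

theory Defs
  imports "HOL-Probability.Probability"
begin

definition switching_cost :: "'a set \<Rightarrow> ('a \<Rightarrow> 'a \<Rightarrow> real) \<Rightarrow> bool" where
  "switching_cost S sc \<longleftrightarrow>
     (\<forall>s\<in>S. \<forall>s'\<in>S. (s = s' \<longrightarrow> sc s s' = 0) \<and> (s \<noteq> s' \<longrightarrow> sc s s' \<in> {0<..1}))"

text \<open>
  A reward sequence is \<open>r :: nat \<Rightarrow> 'a list \<Rightarrow> real\<close>, where \<open>r t\<close> is only meaningful on lists
  \<open>[s\<^sub>1, \<dots>, s\<^sub>t]\<close> of length \<open>t \<ge> 1\<close> over \<open>S\<close> (oldest configuration first).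
\<close>

definition adaptive_adversary :: "'a set \<Rightarrow> (nat \<Rightarrow> 'a list \<Rightarrow> real) \<Rightarrow> bool" where
  "adaptive_adversary S r \<longleftrightarrow>
     (\<forall>t\<ge>1. \<forall>h. length h = t \<and> set h \<subseteq> S \<longrightarrow> r t h \<in> {0..1})"

text \<open>
  A strategy maps the past configurations \<open>[A\<^sub>0, \<dots>, A\<^sub>t\<^sub>-\<^sub>1]\<close> and the rewards observed at
  timesteps \<open>1, \<dots>, t - 1\<close> to the distribution of \<open>A\<^sub>t\<close>. The horizon is not an argument.
\<close>

definition mtd_strategy :: "'a set \<Rightarrow> ('a list \<Rightarrow> real list \<Rightarrow> 'a pmf) \<Rightarrow> bool" where
  "mtd_strategy S \<sigma> \<longleftrightarrow>
     (\<forall>h \<rho>. h \<noteq> [] \<and> set h \<subseteq> S \<and> length h = Suc (length \<rho>) \<and> set \<rho> \<subseteq> {0..1} \<longrightarrow>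
        set_pmf (\<sigma> h \<rho>) \<subseteq> S)"

definition observed_rewards :: "(nat \<Rightarrow> 'a list \<Rightarrow> real) \<Rightarrow> 'a list \<Rightarrow> real list" where
  "observed_rewards r h = map (\<lambda>t. r t (take t h)) [1..<Suc (length h)]"

text \<open>The joint distribution of \<open>[A\<^sub>1, \<dots>, A\<^sub>T]\<close>; the initial \<open>A\<^sub>0 = s\<^sub>0\<close> is not in the list.\<close>

primrec play ::
  "'a \<Rightarrow> ('a list \<Rightarrow> real list \<Rightarrow> 'a pmf) \<Rightarrow> (nat \<Rightarrow> 'a list \<Rightarrow> real) \<Rightarrow> nat \<Rightarrow> 'a list pmf" where
  "play s0 \<sigma> r 0 = return_pmf []"
| "play s0 \<sigma> r (Suc T) =
     bind_pmf (play s0 \<sigma> r T)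
       (\<lambda>h. map_pmf (\<lambda>a. h @ [a]) (\<sigma> (s0 # h) (observed_rewards r h)))"

text \<open>Below \<open>h = [A\<^sub>1, \<dots>, A\<^sub>T]\<close>, so \<open>(s0 # h) ! t\<close> is \<open>A\<^sub>t\<close> for \<open>0 \<le> t \<le> T\<close>.\<close>

definition defender_total ::
  "'a \<Rightarrow> ('a \<Rightarrow> 'a \<Rightarrow> real) \<Rightarrow> (nat \<Rightarrow> 'a list \<Rightarrow> real) \<Rightarrow> nat \<Rightarrow> 'a list \<Rightarrow> real" where
  "defender_total s0 sc r T h =
     (\<Sum>t=1..T. r t (take t h) - sc ((s0 # h) ! (t - 1)) ((s0 # h) ! t))"

definition policy_regret ::
  "'a set \<Rightarrow> ('a \<Rightarrow> 'a \<Rightarrow> real) \<Rightarrow> 'a \<Rightarrow> ('a list \<Rightarrow> real list \<Rightarrow> 'a pmf) \<Rightarrow>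
     (nat \<Rightarrow> 'a list \<Rightarrow> real) \<Rightarrow> nat \<Rightarrow> real" where
  "policy_regret S sc s0 \<sigma> r T =
     Max ((\<lambda>b. \<Sum>t=1..T. r t (replicate t b)) ` S)
     - measure_pmf.expectation (play s0 \<sigma> r T) (defender_total s0 sc r T)"

end

(*
  The distribution of A_1 is fixed before the adversary is. Pick b with P(A_1 = b) > 0. The
  adversary pays 0 forever if the defender opened with b, and 1 forever otherwise. Any constant
  competitor other than b earns T, whereas the defender earns at most T * P(A_1 \<noteq> b) in
  expectation, so the regret is at least T * P(A_1 = b).
*)
theory Submission
  imports Defs
begin

lemma set_observed_rewards:
  assumes "adaptive_adversary S r" "set h \<subseteq> S"
  shows "set (observed_rewards r h) \<subseteq> {0..1}"
proof
  fix x assume "x \<in> set (observed_rewards r h)"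
  then obtain t where t: "1 \<le> t" "t \<le> length h" "x = r t (take t h)"
    unfolding observed_rewards_def by (force simp del: upt_Suc)
  have "set (take t h) \<subseteq> S"
    using set_take_subset assms(2) by (rule order_trans)
  then show "x \<in> {0..1}"
    using assms(1) t unfolding adaptive_adversary_def by (metis length_take min.absorb2)
qed

lemma length_observed_rewards [simp]: "length (observed_rewards r h) = length h"
  by (simp add: observed_rewards_def del: upt_Suc)

lemma set_pmf_play_length:
  "h \<in> set_pmf (play s0 \<sigma> r T) \<Longrightarrow> length h = T"
  by (induction T arbitrary: h) auto

lemma set_pmf_play_subset:
  assumes "mtd_strategy S \<sigma>" "adaptive_adversary S r" "s0 \<in> S"
  shows "h \<in> set_pmf (play s0 \<sigma> r T) \<Longrightarrow> set h \<subseteq> S"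
proof (induction T arbitrary: h)
  case (Suc T)
  then obtain h' a where h': "h' \<in> set_pmf (play s0 \<sigma> r T)" "h = h' @ [a]"
      and a: "a \<in> set_pmf (\<sigma> (s0 # h') (observed_rewards r h'))"
    by auto
  have S: "set h' \<subseteq> S"
    using Suc.IH h'(1) .
  \<comment> \<open>\<open>mtd_strategy\<close> constrains \<open>\<sigma>\<close> only on histories
    inside \<open>S\<close> with rewards in [0,1]; \<open>S\<close> and
    \<open>set_observed_rewards\<close> supply these two premises.\<close>
  have "set_pmf (\<sigma> (s0 # h') (observed_rewards r h')) \<subseteq> S"
    using assms(1,3) S set_observed_rewards[OF assms(2) S]
    unfolding mtd_strategy_def by simp
  with a S h'(2) show ?case by auto
qed simp

text \<open>Finite support makes every real function of the play integrable, as monotonicity of the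
  expectation requires.\<close>

lemma finite_set_pmf_play:
  assumes "mtd_strategy S \<sigma>" "adaptive_adversary S r" "s0 \<in> S" "finite S"
  shows "finite (set_pmf (play s0 \<sigma> r T))"
proof (rule finite_subset)
  show "set_pmf (play s0 \<sigma> r T) \<subseteq> {h. set h \<subseteq> S \<and> length h = T}"
    by (intro subsetI CollectI conjI set_pmf_play_subset[OF assms(1-3)] set_pmf_play_length)
qed (rule finite_lists_length_eq[OF assms(4)])

text \<open>The first move is drawn before any reward is observed, and later rounds only append to
  the history. Hence the law of the first move is the same against every \<open>r\<close>, so an
  adversary may be built from it without circularity.\<close>

lemma map_hd_play: "map_pmf hd (play s0 \<sigma> r (Suc T)) = \<sigma> [s0] []"
proof (induction T)
  case 0
  show ?case
    by (simp add: bind_return_pmf pmf.map_comp o_def observed_rewards_def)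
next
  case (Suc T)
  let ?P = "play s0 \<sigma> r (Suc T)"
  let ?\<tau> = "\<lambda>h. \<sigma> (s0 # h) (observed_rewards r h)"
  have "map_pmf hd (play s0 \<sigma> r (Suc (Suc T))) =
      bind_pmf ?P (\<lambda>h. map_pmf (\<lambda>a. hd (h @ [a])) (?\<tau> h))"
    by (simp only: play.simps(2)[of s0 \<sigma> r "Suc T"] map_bind_pmf pmf.map_comp o_def)
  also have "\<dots> = bind_pmf ?P (\<lambda>h. return_pmf (hd h))"
  proof (rule bind_pmf_cong[OF refl])
    fix h assume "h \<in> set_pmf ?P"
    then have "length h = Suc T"
      by (rule set_pmf_play_length)
    \<comment> \<open>Nonemptiness gives \<open>hd (h @ [a]) = hd h\<close>, so the new move is
      discarded and its distribution collapses to a point mass.\<close>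
    then have "h \<noteq> []"
      by auto
    then show "map_pmf (\<lambda>a. hd (h @ [a])) (?\<tau> h) = return_pmf (hd h)"
      by (simp del: play.simps)
  qed
  also have "\<dots> = map_pmf hd ?P"
    by (simp only: map_pmf_def)
  finally show ?case
    using Suc.IH by simp
qed

text \<open>Switching costs are nonnegative on \<open>S\<close>, so dropping them can only raise the
  total.\<close>

lemma defender_total_le:
  assumes "switching_cost S sc" "set (s0 # h) \<subseteq> S" "length h = T"
  shows "defender_total s0 sc r T h \<le> (\<Sum>t=1..T. r t (take t h))"
  unfolding defender_total_def
proof (rule sum_mono)
  fix t assume t: "t \<in> {1..T}"
  have *: "(s0 # h) ! i \<in> S" if "i \<le> T" for i
    using that assms(3) by (intro subsetD[OF assms(2)] nth_mem) simp
  have "sc x y \<ge> 0" if "x \<in> S" "y \<in> S" for x y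
    using assms(1) that unfolding switching_cost_def
    by (metis greaterThanAtMost_iff less_eq_real_def order_refl)
  then have "sc ((s0 # h) ! (t - 1)) ((s0 # h) ! t) \<ge> 0"
    using * t by (metis atLeastAtMost_iff diff_le_self order_trans)
  then show "r t (take t h) - sc ((s0 # h) ! (t - 1)) ((s0 # h) ! t) \<le> r t (take t h)"
    by simp
qed

text \<open>Reward histories start at timestep 1, so \<open>hd h\<close> is the first chosen
  configuration and not \<open>s0\<close>.\<close>

definition opening_adversary :: "'a \<Rightarrow> nat \<Rightarrow> 'a list \<Rightarrow> real" where
  "opening_adversary b t h = of_bool (hd h \<noteq> b)"

lemma adaptive_adversary_opening: "adaptive_adversary S (opening_adversary b)"
  by (simp add: adaptive_adversary_def opening_adversary_def)

lemma sum_opening_adversary: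
  "(\<Sum>t=1..T. opening_adversary b t (take t h)) = real T * of_bool (hd h \<noteq> b)"
proof -
  have "(\<Sum>t=1..T. opening_adversary b t (take t h)) = (\<Sum>t=1..T. of_bool (hd h \<noteq> b))"
    \<comment> \<open>Since \<open>t\<close> starts at 1, the prefix \<open>take t h\<close> has the
      same head as \<open>h\<close>.\<close>
    by (intro sum.cong) (auto simp: opening_adversary_def hd_take)
  then show ?thesis by simp
qed

lemma expectation_defender_total_opening_le:
  assumes "finite S" "switching_cost S sc" "s0 \<in> S" "mtd_strategy S \<sigma>" "T \<ge> 1"
  shows "measure_pmf.expectation (play s0 \<sigma> (opening_adversary b) T)
           (defender_total s0 sc (opening_adversary b) T) \<le> real T * (1 - pmf (\<sigma> [s0] []) b)"
proof -
  let ?r = "opening_adversary b"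
  let ?P = "play s0 \<sigma> ?r T"
  note adv = adaptive_adversary_opening[of S b]
  have fin: "finite (set_pmf ?P)"
    using finite_set_pmf_play[OF assms(4) adv assms(3,1)] .
  \<comment> \<open>\<open>T \<ge> 1\<close> allows writing \<open>T\<close> as a successor, so that
    a first move exists.\<close>
  have marginal: "map_pmf hd ?P = \<sigma> [s0] []"
    using map_hd_play[of s0 \<sigma> ?r "T - 1"] assms(5) by simp
  have "measure_pmf.expectation ?P (defender_total s0 sc ?r T)
      \<le> measure_pmf.expectation ?P (\<lambda>h. real T * of_bool (hd h \<noteq> b))"
  proof (intro integral_mono_AE integrable_measure_pmf_finite[OF fin] AE_pmfI)
    fix h assume h: "h \<in> set_pmf ?P"
    have "set (s0 # h) \<subseteq> S"
      using set_pmf_play_subset[OF assms(4) adv assms(3) h] assms(3) by simp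
    then show "defender_total s0 sc ?r T h \<le> real T * of_bool (hd h \<noteq> b)"
      using defender_total_le[OF assms(2) _ set_pmf_play_length[OF h], of s0 ?r]
      by (simp only: sum_opening_adversary)
  qed
  also have "\<dots> = real T * measure_pmf.expectation (map_pmf hd ?P) (\<lambda>a. of_bool (a \<noteq> b))"
    by simp
  also have "measure_pmf.expectation (map_pmf hd ?P) (\<lambda>a. of_bool (a \<noteq> b))
      = measure_pmf.expectation (\<sigma> [s0] []) (indicator (- {b}))"
    unfolding marginal by (intro Bochner_Integration.integral_cong) (auto simp: indicator_def)
  also have "\<dots> = 1 - pmf (\<sigma> [s0] []) b"
    using measure_pmf.prob_compl[of "{b}" "\<sigma> [s0] []"]
    by (simp add: Compl_eq_Diff_UNIV measure_pmf_single)
  finally show ?thesis .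
qed

theorem theorem1:
  fixes S :: "'a set" and n :: nat and sc :: "'a \<Rightarrow> 'a \<Rightarrow> real" and s0 :: 'a
    and \<sigma> :: "'a list \<Rightarrow> real list \<Rightarrow> 'a pmf"
  assumes "finite S" and "card S = n" and "n > 1"
    and "switching_cost S sc"
    and "s0 \<in> S"
    and "mtd_strategy S \<sigma>"
  shows "\<exists>r. adaptive_adversary S r \<and>
           (\<exists>c>0. \<exists>T0::nat. \<forall>T\<ge>T0. policy_regret S sc s0 \<sigma> r T \<ge> c * real T)"
proof -
  \<comment> \<open>The probability of this support point is positive and independent of
    \<open>T\<close>; it becomes the constant \<open>c\<close>, with \<open>T0 = 1\<close>.\<close>
  obtain b where b: "b \<in> set_pmf (\<sigma> [s0] [])"
    using set_pmf_not_empty[of "\<sigma> [s0] []"] by blast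
  have "\<not> S \<subseteq> {b}"
    using card_mono[of "{b}" S] assms(2,3) by auto
  then obtain x where x: "x \<in> S" "x \<noteq> b"
    by blast
  let ?r = "opening_adversary b"
  have "policy_regret S sc s0 \<sigma> ?r T \<ge> pmf (\<sigma> [s0] []) b * real T" if "T \<ge> 1" for T
  proof -
    \<comment> \<open>The constant history of \<open>x\<close> opens with
      \<open>x \<noteq> b\<close>, so each of its \<open>T\<close> rewards is 1.\<close>
    have "real T = (\<Sum>t=1..T. ?r t (replicate t x))"
      using that x(2) by (simp add: opening_adversary_def)
    also have "\<dots> \<le> Max ((\<lambda>b'. \<Sum>t=1..T. ?r t (replicate t b')) ` S)"
      using assms(1) x(1) by (intro Max_ge) auto
    finally show ?thesis
      using expectation_defender_total_opening_le[OF assms(1,4,5,6) that, of b]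
      by (simp add: policy_regret_def algebra_simps)
  qed
  moreover have "pmf (\<sigma> [s0] []) b > 0"
    using b by (rule pmf_positive)
  ultimately show ?thesis
    using adaptive_adversary_opening[of S b] by blast
qed

end
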